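(* Let $k$ be a field of characteristic $0$, let $(V,\Delta,\cdot)$ be a Batalin-Vilkovisky (BV) algebra over $k$, let $[v,w]:=\Delta(vw)-\Delta(v)w-(-1)^{|v|}v\Delta(w)$ be the associated bracket, and let $L=(V,\Delta,[\,,\,])$ be the associated odd differential graded Lie algebra, whose differential is $\Delta$. Then $L$ is smooth formal.
   Context: **BV algebra.** A BV algebra is a triple $(V,\Delta,\cdot)$ where $(V,\cdot)$ is a $\mathbb{Z}$-graded, (graded-)commutative, associative, unital algebra over $k$, and $\Delta:V^j\to V^{j-1}$ is a linear map with $\Delta^2=0$ such that for each $v\in V^j$ the operator $d_v(w)=\Delta(v w)-\Delta(v) w-(-1)^{j}v\Delta(w)$ is a derivation of degree $j-1$ of the product, i.e. $d_v(ab)=d_v(a)b+(-1)^{(j-1)|a|}a\,d_v(b)$. The bracket is $[v,w]:=d_v(w)$; it has degree $-1$, and $(V,\Delta,[\,,\,])$ is an odd differential graded Lie algebra. **Smooth formal.** Let $H:=\ker(\Delta)/\operatorname{im}(\Delta)$. Choose a homogeneous basis of $H$ indexed by $i\in I$ and let $t^i$ be the dual coordinates, which are graded-commuting formal variables with $|t^i|$ equal to minus the degree of the $i$-th basis element. Let $V[[t]]$ denote formal power series in the variables $t^i$ with coefficients in $V$ (one coefficient for each monomial in finitely many of the variables), with the product following the Koszul sign rule and with $\Delta$ acting on coefficients, $\Delta(v\,t^{i_1}\cdots t^{i_n})=\Delta(v)\,t^{i_1}\cdots t^{i_n}$. The bracket is extended to $V[[t]]$ by the same formula in terms of $\Delta$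 and the product. The odd dgLa $L=(V,\Delta,[\,,\,])$ is *smooth formal* if there exists a versal solution to the Maurer-Cartan equation, i.e. (for some choice of homogeneous basis of $H$) an element of total degree zero $$\Gamma=\sum \gamma_i t^i+\sum\gamma_{ij}t^it^j+\sum\gamma_{ijk}t^it^jt^k+\cdots\in V[[t]]$$ with no constant term in $t$, satisfying $$\Delta\Gamma+\tfrac12[\Gamma,\Gamma]=0,$$ where each $\gamma_i\in V$ is a $\Delta$-closed homogeneous representative of the $i$-th basis class of $H$ (the class dual to $t^i$). *)

theory Defs
  imports Complex_Main "HOL-Library.Multiset" "HOL-Library.Set_Algebras"
begin

text \<open>The sign \<open>(-1)^n\<close> for an integer exponent.\<close>

definition signed :: "int \<Rightarrow> 'a::ab_group_add \<Rightarrow> 'a" where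
  "signed n x = (if even n then x else - x)"

definition is_decomposition :: "(int \<Rightarrow> 'v::ab_group_add set) \<Rightarrow> 'v \<Rightarrow> (int \<Rightarrow> 'v) \<Rightarrow> bool" where
  "is_decomposition V v c \<longleftrightarrow>
     (\<forall>j. c j \<in> V j) \<and> finite {j. c j \<noteq> 0} \<and> v = (\<Sum>j | c j \<noteq> 0. c j)"

text \<open>The bracket \<open>[v, w]\<close> for \<open>v\<close> homogeneous of degree \<open>j\<close>.\<close>

definition bv_bracket :: "('v::ring \<Rightarrow> 'v) \<Rightarrow> int \<Rightarrow> 'v \<Rightarrow> 'v \<Rightarrow> 'v" where
  "bv_bracket \<Delta> j v w = \<Delta> (v * w) - \<Delta> v * w - signed j (v * \<Delta> w)"

text \<open>
  The class \<open>ring\<close> provides an associative, biadditive product and no unit; the unit is the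
  explicit parameter \<open>u\<close>, so that the zero algebra (excluded by \<open>ring_1\<close>) is allowed.
\<close>

locale bv_algebra = vector_space scale
  for scale :: "'k::field_char_0 \<Rightarrow> 'v::ring \<Rightarrow> 'v" +
  fixes u :: 'v
    and V :: "int \<Rightarrow> 'v set"
    and \<Delta> :: "'v \<Rightarrow> 'v"
  assumes scale_mult_left: "scale c a * b = scale c (a * b)"
    and scale_mult_right: "a * scale c b = scale c (a * b)"
    and unit_left: "u * a = a"
    and unit_right: "a * u = a"
    and subspace_V: "subspace (V j)"
    and direct_sum: "\<exists>!c. is_decomposition V v c"
    and unit_degree: "u \<in> V 0"
    and mult_degree: "\<lbrakk>a \<in> V i; b \<in> V j\<rbrakk> \<Longrightarrow> a * b \<in> V (i + j)"
    and graded_commute: "\<lbrakk>a \<in> V i; b \<in> V j\<rbrakk> \<Longrightarrow> a * b = signed (i * j) (b * a)"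
    and linear_Delta: "Vector_Spaces.linear scale scale \<Delta>"
    and Delta_degree: "v \<in> V j \<Longrightarrow> \<Delta> v \<in> V (j - 1)"
    and Delta_Delta: "\<Delta> (\<Delta> v) = 0"
    and bracket_derivation: "\<lbrakk>v \<in> V j; a \<in> V i\<rbrakk> \<Longrightarrow>
      bv_bracket \<Delta> j v (a * b) =
        bv_bracket \<Delta> j v a * b + signed ((j - 1) * i) (a * bv_bracket \<Delta> j v b)"
begin

definition component :: "'v \<Rightarrow> int \<Rightarrow> 'v" where
  "component v = (THE c. is_decomposition V v c)"

text \<open>The linear extension of \<open>v \<mapsto> (-1)^(n * |v|) v\<close> from homogeneous to arbitrary elements.\<close>

definition twist :: "int \<Rightarrow> 'v \<Rightarrow> 'v" where
  "twist n v = (\<Sum>j | component v j \<noteq> 0. signed (n * j) (component v j))"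


subsection \<open>The homology \<open>ker \<Delta> / im \<Delta>\<close>, as a set of cosets\<close>

definition homology :: "'v set set" where
  "homology = {{v} + range \<Delta> | v. \<Delta> v = 0}"

text \<open>
  A linear combination of cosets, formed with the pointwise operations on sets. The summand
  \<open>range \<Delta>\<close> is the zero of the quotient; it makes the result a coset also when all the
  coefficients vanish.
\<close>

definition class_comb :: "('v set \<Rightarrow> 'k) \<Rightarrow> 'v set set \<Rightarrow> 'v set" where
  "class_comb c F = range \<Delta> + (\<Sum>b\<in>F. scale (c b) ` b)"

definition homology_basis :: "'v set set \<Rightarrow> bool" where
  "homology_basis B \<longleftrightarrow> B \<subseteq> homology \<and>
     (\<forall>F c. finite F \<and> F \<subseteq> B \<and> class_comb c F = range \<Delta> \<longrightarrow> (\<forall>b\<in>F. c b = 0)) \<and>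
     (\<forall>h\<in>homology. \<exists>F c. finite F \<and> F \<subseteq> B \<and> h = class_comb c F)"

text \<open>A basis of homogeneous classes, with \<open>deg b\<close> the degree of \<open>b\<close>.\<close>

definition homogeneous_basis :: "'v set set \<Rightarrow> ('v set \<Rightarrow> int) \<Rightarrow> bool" where
  "homogeneous_basis B deg \<longleftrightarrow> homology_basis B \<and> (\<forall>b\<in>B. b \<inter> V (deg b) \<noteq> {})"


subsection \<open>Formal power series in graded-commuting variables\<close>

text \<open>
  There is one variable \<open>t^i\<close> of degree \<open>- deg i\<close> for each \<open>i \<in> I\<close>. A monomial is given by the
  multiset of its variables; odd variables square to zero. The linear order \<open>r\<close> on \<open>I\<close> fixes the
  sign of a monomial: \<open>t^m\<close> is the product of the variables in \<open>m\<close> in increasing order.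
  A power series \<open>f\<close> stands for the sum of the terms \<open>f m t^m\<close>, coefficients on the left.
\<close>

definition monomial :: "'i set \<Rightarrow> ('i \<Rightarrow> int) \<Rightarrow> 'i multiset \<Rightarrow> bool" where
  "monomial I deg m \<longleftrightarrow> set_mset m \<subseteq> I \<and> (\<forall>i. odd (deg i) \<longrightarrow> count m i \<le> 1)"

definition monomial_degree :: "('i \<Rightarrow> int) \<Rightarrow> 'i multiset \<Rightarrow> int" where
  "monomial_degree deg m = (\<Sum>i\<in>#m. - deg i)"

definition power_series :: "'i set \<Rightarrow> ('i \<Rightarrow> int) \<Rightarrow> ('i multiset \<Rightarrow> 'v) set" where
  "power_series I deg = {f. \<forall>m. \<not> monomial I deg m \<longrightarrow> f m = 0}"

text \<open>The number of transpositions of odd variables that turn \<open>t^p t^q\<close> into \<open>t^(p + q)\<close>.\<close>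

definition odd_inversions :: "('i \<Rightarrow> int) \<Rightarrow> 'i rel \<Rightarrow> 'i multiset \<Rightarrow> 'i multiset \<Rightarrow> nat" where
  "odd_inversions deg r p q =
     card {(i, j). i \<in># p \<and> j \<in># q \<and> odd (deg i) \<and> odd (deg j) \<and> (j, i) \<in> r \<and> i \<noteq> j}"

text \<open>Determined by \<open>(a t^p) (b t^q) = (-1)^(|t^p| * |b|) a b t^p t^q\<close>.\<close>

definition ps_mult ::
  "'i set \<Rightarrow> ('i \<Rightarrow> int) \<Rightarrow> 'i rel \<Rightarrow> ('i multiset \<Rightarrow> 'v) \<Rightarrow> ('i multiset \<Rightarrow> 'v) \<Rightarrow> 'i multiset \<Rightarrow> 'v"
where
  "ps_mult I deg r f g m =
     (if monomial I deg m then
        \<Sum>p | p \<subseteq># m.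
          signed (int (odd_inversions deg r p (m - p)))
            (f p * twist (monomial_degree deg p) (g (m - p)))
      else 0)"

definition ps_Delta :: "('i multiset \<Rightarrow> 'v) \<Rightarrow> 'i multiset \<Rightarrow> 'v" where
  "ps_Delta f m = \<Delta> (f m)"

text \<open>The linear extension of \<open>f \<mapsto> (-1)^|f| f\<close>, where \<open>|f|\<close> is the total degree.\<close>

definition ps_parity :: "('i \<Rightarrow> int) \<Rightarrow> ('i multiset \<Rightarrow> 'v) \<Rightarrow> 'i multiset \<Rightarrow> 'v" where
  "ps_parity deg f m = signed (monomial_degree deg m) (twist 1 (f m))"

definition ps_bracket ::
  "'i set \<Rightarrow> ('i \<Rightarrow> int) \<Rightarrow> 'i rel \<Rightarrow> ('i multiset \<Rightarrow> 'v) \<Rightarrow> ('i multiset \<Rightarrow> 'v) \<Rightarrow> 'i multiset \<Rightarrow> 'v"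
where
  "ps_bracket I deg r f g m =
     ps_Delta (ps_mult I deg r f g) m - ps_mult I deg r (ps_Delta f) g m
       - ps_mult I deg r (ps_parity deg f) (ps_Delta g) m"

definition total_degree :: "('i \<Rightarrow> int) \<Rightarrow> int \<Rightarrow> ('i multiset \<Rightarrow> 'v) \<Rightarrow> bool" where
  "total_degree deg n f \<longleftrightarrow> (\<forall>m. f m \<in> V (n - monomial_degree deg m))"

definition maurer_cartan :: "'i set \<Rightarrow> ('i \<Rightarrow> int) \<Rightarrow> 'i rel \<Rightarrow> ('i multiset \<Rightarrow> 'v) \<Rightarrow> bool" where
  "maurer_cartan I deg r \<Gamma> \<longleftrightarrow>
     (\<forall>m. ps_Delta \<Gamma> m + scale (1 / 2) (ps_bracket I deg r \<Gamma> \<Gamma> m) = 0)"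

text \<open>The variables are indexed by the basis \<open>B\<close> itself, so \<open>\<Gamma> {#b#}\<close> is the coefficient of \<open>t^b\<close>.\<close>

definition versal_solution ::
  "'v set set \<Rightarrow> ('v set \<Rightarrow> int) \<Rightarrow> 'v set rel \<Rightarrow> ('v set multiset \<Rightarrow> 'v) \<Rightarrow> bool"
where
  "versal_solution B deg r \<Gamma> \<longleftrightarrow>
     \<Gamma> \<in> power_series B deg \<and> total_degree deg 0 \<Gamma> \<and> \<Gamma> {#} = 0 \<and>
     maurer_cartan B deg r \<Gamma> \<and>
     (\<forall>b\<in>B. \<Gamma> {#b#} \<in> b \<and> \<Delta> (\<Gamma> {#b#}) = 0 \<and> \<Gamma> {#b#} \<in> V (deg b))"

text \<open>
  Reordering the variables only changes the signs of the coefficients, so the choice of \<open>r\<close> is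
  immaterial. Linear orders on \<open>B\<close> exist by the well-ordering theorem (\<open>well_order_on\<close>).
\<close>

definition smooth_formal :: bool where
  "smooth_formal \<longleftrightarrow>
     (\<exists>B deg. homogeneous_basis B deg \<and>
        (\<forall>r. linear_order_on B r \<longrightarrow> (\<exists>\<Gamma>. versal_solution B deg r \<Gamma>)))"

end

end

theory Submission
  imports Defs
begin

text \<open>
  The operator \<open>\<Delta>\<close> is a differential operator of order two that kills the unit, and for
  \<open>\<Gamma>\<close> of total degree zero without constant term the Maurer-Cartan equation says exactly that
  \<open>\<Delta> (exp \<Gamma>) = 0\<close>: one has \<open>\<Delta> (exp \<Gamma>) = exp \<Gamma> (\<Delta> \<Gamma> + 1/2 [\<Gamma>, \<Gamma>])\<close>. This is solved by
  inverting the exponential. Choose closed homogeneous representatives \<open>\<gamma>\<^sub>b\<close> of a homogeneous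
  basis of the homology, put \<open>X = \<Sum>\<^sub>b \<gamma>\<^sub>b t\<^sup>b\<close>, and take \<open>\<Gamma> = log (1 + X)\<close>. Then
  \<open>\<Delta> (exp \<Gamma>) = \<Delta> 1 + \<Delta> X = 0\<close>, and the linear part of \<open>\<Gamma>\<close> is \<open>X\<close>.

  The proof below does not pass through the exponential but checks the equation on powers of
  \<open>X\<close>. In the graded-commutative algebra of power series, the bracket with \<open>X\<close> is a derivation
  (\<open>bracket_mult\<close>), which gives \<open>\<Delta> X\<^sup>n = (n choose 2) X\<^sup>n\<^sup>-\<^sup>2 [X, X]\<close> (\<open>Delta_pow\<close>) and hence
  \<open>[X\<^sup>a, X\<^sup>b] = a b X\<^sup>a\<^sup>+\<^sup>b\<^sup>-\<^sup>2 [X, X]\<close> (\<open>bracket_pow_pow\<close>). With \<open>\<Gamma> = \<Sum>\<^sub>n (-1)\<^sup>n\<^sup>+\<^sup>1 X\<^sup>n / n\<close>, the part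
  of \<open>\<Delta> \<Gamma> + 1/2 [\<Gamma>, \<Gamma>]\<close> of polynomial degree \<open>N\<close> is \<open>X\<^sup>N\<^sup>-\<^sup>2 [X, X]\<close> times
  \<open>(-1)\<^sup>N\<^sup>+\<^sup>1 (N - 1) / 2\<close>, from \<open>\<Delta> \<Gamma>\<close>, plus \<open>(-1)\<^sup>N (N - 1) / 2\<close>, from
  \<open>1/2 [\<Gamma>, \<Gamma>]\<close> with one summand for each \<open>a + b = N\<close> with \<open>a, b \<ge> 1\<close>; the two cancel (\<open>maurer_cartan_logarithm\<close>).

  What remains is linear algebra: the homology has a homogeneous basis because a cycle is a sum
  of homogeneous cycles (\<open>homogeneous_basis_exists\<close>).
\<close>

section \<open>Signs and sums over submultisets\<close>

lemma signed_signed: "signed a (signed b x) = signed (a + b) x"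
  by (simp add: signed_def)

lemma signed_zero [simp]: "signed n 0 = 0"
  by (simp add: signed_def)

lemma signed_add: "signed n (x + y) = signed n x + signed n y"
  by (simp add: signed_def)

lemma signed_minus: "signed n (x - y) = signed n x - signed n y"
  by (simp add: signed_def)

lemma signed_sum: "signed n (sum f A) = (\<Sum>x\<in>A. signed n (f x))"
  by (simp add: signed_def sum_negf)

lemma signed_mult_left: "signed n x * y = signed n (x * y :: 'a::ring)"
  by (simp add: signed_def)

lemma signed_mult_right: "x * signed n y = signed n (x * y :: 'a::ring)"
  by (simp add: signed_def)

lemma signed_cong: "(even a \<longleftrightarrow> even b) \<Longrightarrow> signed a x = signed b x"
  by (simp add: signed_def)

lemma finite_submultisets: "finite {p. p \<subseteq># m}"
proof (induction m)
  case (add x m)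
  have "{p. p \<subseteq># add_mset x m} \<subseteq> {p. p \<subseteq># m} \<union> add_mset x ` {p. p \<subseteq># m}"
  proof
    fix p assume "p \<in> {p. p \<subseteq># add_mset x m}"
    then have p: "p \<subseteq># add_mset x m" by simp
    show "p \<in> {p. p \<subseteq># m} \<union> add_mset x ` {p. p \<subseteq># m}"
    proof (cases "x \<in># p")
      case True
      then obtain q where "p = add_mset x q" by (metis insert_DiffM)
      with p show ?thesis by simp
    next
      case False
      have "count p y \<le> count m y" for y
        using mset_subset_eq_count[OF p, of y] False by (cases "y = x") (auto simp: not_in_iff)
      then show ?thesis by (simp add: subseteq_mset_def)
    qed
  qed
  then show ?case using add by (meson finite_UnI finite_imageI finite_subset)
qed simp

lemma sum_submultisets_flip:
  "(\<Sum>p | p \<subseteq># m. F p (m - p)) = (\<Sum>p | p \<subseteq># m. F (m - p) p)"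
  by (rule sum.reindex_bij_witness[where i = "\<lambda>p. m - p" and j = "\<lambda>p. m - p"])
     (auto simp: subset_mset.diff_diff_right)

lemma submultiset_pair_iff: "p \<subseteq># m \<and> q \<subseteq># m - p \<longleftrightarrow> p + q \<subseteq># m"
  by (metis add.commute mset_subset_eq_add_left subset_mset.le_diff_conv2 subset_mset.order_trans)

text \<open>
  The two ways of summing over the decompositions \<open>m = p + q + s\<close>; they match the two
  bracketings of a triple product of power series.
\<close>

lemma sum_submultisets_assoc:
  "(\<Sum>p | p \<subseteq># m. \<Sum>q | q \<subseteq># p. F q (p - q) (m - p)) =
   (\<Sum>p | p \<subseteq># m. \<Sum>q | q \<subseteq># m - p. F p q (m - p - q))"
proof -
  have "(\<Sum>(p, q)\<in>Sigma {p. p \<subseteq># m} (\<lambda>p. {q. q \<subseteq># p}). F q (p - q) (m - p)) =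
      (\<Sum>(p, q)\<in>{(p, q). p + q \<subseteq># m}. F p q (m - p - q))"
    by (rule sum.reindex_bij_witness[where i = "\<lambda>(p, q). (p + q, p)" and j = "\<lambda>(p, q). (q, p - q)"])
       (auto simp: diff_diff_eq)
  moreover have "Sigma {p. p \<subseteq># m} (\<lambda>p. {q. q \<subseteq># m - p}) = {(p, q). p + q \<subseteq># m}"
    using submultiset_pair_iff by blast
  ultimately show ?thesis
    by (simp add: sum.Sigma finite_submultisets)
qed

lemma sum_submultisets_swap:
  "(\<Sum>p | p \<subseteq># m. \<Sum>q | q \<subseteq># m - p. F p q (m - p - q)) =
   (\<Sum>q | q \<subseteq># m. \<Sum>p | p \<subseteq># m - q. F p q (m - q - p))"
proof -
  have "(\<Sum>(p, q)\<in>{(p, q). p + q \<subseteq># m}. F p q (m - p - q)) =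
      (\<Sum>(q, p)\<in>{(q, p). q + p \<subseteq># m}. F p q (m - q - p))"
    by (rule sum.reindex_bij_witness[where i = "\<lambda>(p, q). (q, p)" and j = "\<lambda>(p, q). (q, p)"])
       (auto simp: diff_diff_eq add.commute)
  moreover have "Sigma {p. p \<subseteq># m} (\<lambda>p. {q. q \<subseteq># m - p}) = {(p, q). p + q \<subseteq># m}"
    using submultiset_pair_iff by blast
  ultimately show ?thesis
    by (simp add: sum.Sigma finite_submultisets)
qed

context bv_algebra
begin

section \<open>BV algebras\<close>

sublocale Delta: Vector_Spaces.linear scale scale \<Delta>
  by (rule linear_Delta)

lemma signed_in_V: "v \<in> V j \<Longrightarrow> signed n v \<in> V j"
  by (simp add: signed_def subspace_neg[OF subspace_V])

lemma zero_in_V: "0 \<in> V j"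
  using subspace_0[OF subspace_V] .

lemma Delta_signed: "\<Delta> (signed n v) = signed n (\<Delta> v)"
  by (simp add: signed_def Delta.neg)

lemma scale_signed: "scale c (signed n v) = signed n (scale c v)"
  by (simp add: signed_def)

lemma twist_homogeneous:
  assumes "v \<in> V j"
  shows "twist n v = signed (n * j) v"
proof -
  let ?c = "\<lambda>i. if i = j then v else 0"
  have "is_decomposition V v ?c"
    unfolding is_decomposition_def using assms
    by (cases "v = 0") (auto simp: zero_in_V)
  then have "component v = ?c"
    unfolding component_def using direct_sum[of v] by (metis the1_equality)
  then show ?thesis
    unfolding twist_def by (cases "v = 0") auto
qed

text \<open>
  A derivation kills the unit, and the bracket with \<open>u\<close> sends \<open>w\<close> to \<open>- \<Delta> u * w\<close>.
\<close>

lemma Delta_unit: "\<Delta> u = 0"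
  using bracket_derivation[OF unit_degree unit_degree, of u]
  by (simp add: bv_bracket_def signed_def unit_left unit_right)

lemma bv_bracket_sum: "bv_bracket \<Delta> j v (sum f A) = (\<Sum>x\<in>A. bv_bracket \<Delta> j v (f x))"
  by (simp add: bv_bracket_def sum_distrib_left Delta.sum sum_subtractf signed_sum)

lemma bv_bracket_signed: "bv_bracket \<Delta> j v (signed n w) = signed n (bv_bracket \<Delta> j v w)"
  by (simp add: bv_bracket_def signed_mult_right Delta_signed signed_minus signed_signed add.commute)

end

section \<open>The algebra of power series\<close>

locale bv_power_series = bv_algebra scale u V \<Delta>
  for scale :: "'k::field_char_0 \<Rightarrow> 'v::ring \<Rightarrow> 'v" and u V \<Delta> +
  fixes I :: "'i set" and deg :: "'i \<Rightarrow> int" and r :: "'i rel"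
  assumes order: "linear_order_on I r"
begin

abbreviation monom :: "'i multiset \<Rightarrow> bool" where
  "monom \<equiv> monomial I deg"

abbreviation wt :: "'i multiset \<Rightarrow> int" where
  "wt \<equiv> monomial_degree deg"

abbreviation inversions :: "'i multiset \<Rightarrow> 'i multiset \<Rightarrow> int" where
  "inversions p q \<equiv> int (odd_inversions deg r p q)"

abbreviation mult (infixl "\<star>" 70) where
  "f \<star> g \<equiv> ps_mult I deg r f g"

lemma monom_subset: "monom m \<Longrightarrow> p \<subseteq># m \<Longrightarrow> monom p"
  unfolding monomial_def
  using set_mset_mono[of p m] mset_subset_eq_count[of p m] by (meson le_trans subset_trans)

lemma wt_add: "wt (p + q) = wt p + wt q"
  by (simp add: monomial_degree_def)

lemma wt_diff: "p \<subseteq># m \<Longrightarrow> wt (m - p) = wt m - wt p"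
  using wt_add[of p "m - p"] by simp

text \<open>
  An odd variable occurs at most once in a monomial, hence in only one of two complementary
  factors. This makes the number of odd inversions additive in each argument, as long as the
  product of the factors is again a monomial.
\<close>

lemma monom_disjoint:
  assumes "monom (p + q)" "odd (deg i)" "i \<in># p"
  shows "i \<notin># q"
proof
  assume "i \<in># q"
  then have "count p i > 0" "count q i > 0"
    using assms(3) by simp_all
  moreover have "count (p + q) i \<le> 1"
    using assms(1,2) unfolding monomial_def by blast
  ultimately show False
    using count_union[of p q i] by linarith
qed

lemma finite_inversions:
  "finite {(i, j). i \<in># p \<and> j \<in># q \<and> P i j}"
  by (rule finite_subset[of _ "set_mset p \<times> set_mset q"]) auto

lemma inversions_add_left:
  assumes "monom (p + p')"
  shows "inversions (p + p') q = inversions p q + inversions p' q"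
proof -
  let ?A = "\<lambda>p. {(i, j). i \<in># p \<and> j \<in># q \<and> odd (deg i) \<and> odd (deg j) \<and> (j, i) \<in> r \<and> i \<noteq> j}"
  have "?A (p + p') = ?A p \<union> ?A p'" "?A p \<inter> ?A p' = {}"
    using monom_disjoint[OF assms] by auto
  then show ?thesis
    by (simp add: odd_inversions_def card_Un_disjoint finite_inversions)
qed

lemma inversions_add_right:
  assumes "monom (q + q')"
  shows "inversions p (q + q') = inversions p q + inversions p q'"
proof -
  let ?A = "\<lambda>q. {(i, j). i \<in># p \<and> j \<in># q \<and> odd (deg i) \<and> odd (deg j) \<and> (j, i) \<in> r \<and> i \<noteq> j}"
  have "?A (q + q') = ?A q \<union> ?A q'" "?A q \<inter> ?A q' = {}"
    using monom_disjoint[OF assms] by auto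
  then show ?thesis
    by (simp add: odd_inversions_def card_Un_disjoint finite_inversions)
qed

lemma even_wt_iff:
  "monom p \<Longrightarrow> even (wt p) \<longleftrightarrow> even (card {i \<in> set_mset p. odd (deg i)})"
proof (induction p)
  case (add x p)
  have IH: "even (wt p) \<longleftrightarrow> even (card {i \<in> set_mset p. odd (deg i)})"
    using add monom_subset[of "add_mset x p" p] by simp
  have wt: "wt (add_mset x p) = wt p - deg x"
    by (simp add: monomial_degree_def)
  show ?case
  proof (cases "odd (deg x)")
    case True
    then have "x \<notin># p"
      using add.prems monom_disjoint[of "{#x#}" p x] by simp
    moreover have "{i \<in> set_mset (add_mset x p). odd (deg i)} =
        insert x {i \<in> set_mset p. odd (deg i)}"
      using True by auto
    ultimately show ?thesis using IH wt True by simp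
  next
    case False
    then have "{i \<in> set_mset (add_mset x p). odd (deg i)} = {i \<in> set_mset p. odd (deg i)}"
      by auto
    then show ?thesis using IH wt False by simp
  qed
qed (simp add: monomial_degree_def)

text \<open>
  Since odd variables of \<open>p\<close> and \<open>q\<close> are distinct and linearly ordered, a pair of an odd
  variable of \<open>p\<close> and one of \<open>q\<close> is an inversion for exactly one of the two orders of the factors;
  and \<open>wt p\<close> has the parity of the number of odd variables in \<open>p\<close>.
\<close>

lemma inversions_swap:
  assumes "monom (p + q)"
  shows "even (inversions p q + inversions q p) \<longleftrightarrow> even (wt p * wt q)"
proof -
  let ?O = "\<lambda>p. {i \<in> set_mset p. odd (deg i)}"
  let ?A = "\<lambda>p q. {(i, j). i \<in># p \<and> j \<in># q \<and> odd (deg i) \<and> odd (deg j) \<and> (j, i) \<in> r \<and> i \<noteq> j}"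
  have sub: "set_mset p \<subseteq> I" "set_mset q \<subseteq> I"
    using assms by (auto simp: monomial_def)
  have total: "i \<noteq> j \<and> ((i, j) \<in> r \<or> (j, i) \<in> r)" if "i \<in># p" "odd (deg i)" "j \<in># q" for i j
  proof -
    have "i \<noteq> j"
      using that(3) monom_disjoint[OF assms that(2,1)] by blast
    moreover have "i \<in> I" "j \<in> I"
      using sub that(1,3) by blast+
    moreover have "total_on I r"
      using order by (simp add: linear_order_on_def)
    ultimately show ?thesis
      by (simp add: total_on_def)
  qed
  have antisym: "antisym r"
    using order by (simp add: linear_order_on_def partial_order_on_def)
  let ?B = "(?A q p)\<inverse>"
  have inter: "?A p q \<inter> ?B = {}"
  proof -
    have False if "x \<in> ?A p q" "x \<in> ?B" for x
      using that antisymD[OF antisym, of "fst x" "snd x"] by (cases x) simp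
    then show ?thesis by blast
  qed
  have finB: "finite ?B"
    unfolding finite_converse by (rule finite_inversions)
  have union: "?A p q \<union> ?B = ?O p \<times> ?O q"
  proof (rule set_eqI)
    fix x show "x \<in> ?A p q \<union> ?B \<longleftrightarrow> x \<in> ?O p \<times> ?O q"
      using total[of "fst x" "snd x"] by (cases x) auto
  qed
  have "card (?A p q \<union> ?B) = card (?A p q) + card ?B"
    by (rule card_Un_disjoint[OF finite_inversions finB inter])
  then have "card (?O p) * card (?O q) = card (?A p q) + card (?A q p)"
    unfolding union card_inverse card_cartesian_product .
  then have "inversions p q + inversions q p = int (card (?O p) * card (?O q))"
    unfolding odd_inversions_def by linarith
  moreover have "monom p" "monom q"
    using assms monom_subset by auto
  ultimately show ?thesis
    by (simp only: even_wt_iff even_mult_iff even_of_nat)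
qed

definition homogeneous :: "int \<Rightarrow> ('i multiset \<Rightarrow> 'v) set" where
  "homogeneous n = {f \<in> power_series I deg. total_degree deg n f}"

lemma homogeneous_coeff: "f \<in> homogeneous n \<Longrightarrow> f m \<in> V (n - wt m)"
  by (simp add: homogeneous_def total_degree_def)

lemma homogeneous_nonmonom: "f \<in> homogeneous n \<Longrightarrow> \<not> monom m \<Longrightarrow> f m = 0"
  by (simp add: homogeneous_def power_series_def)

lemma homogeneousI:
  assumes "\<And>m. monom m \<Longrightarrow> f m \<in> V (n - wt m)" "\<And>m. \<not> monom m \<Longrightarrow> f m = 0"
  shows "f \<in> homogeneous n"
proof -
  have "f m \<in> V (n - wt m)" for m
    using assms[of m] by (cases "monom m") (simp_all add: zero_in_V)
  then show ?thesis
    by (simp add: homogeneous_def power_series_def total_degree_def assms(2))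
qed

text \<open>
  The sign exponent in the product \<open>(a t\<^sup>p) (b t\<^sup>q)\<close> when \<open>b t\<^sup>q\<close> has total degree \<open>n\<close>, so that
  \<open>b\<close> has degree \<open>n - wt q\<close>: one contribution for sorting the variables, one for moving \<open>t\<^sup>p\<close>
  past \<open>b\<close>. It replaces the operator \<open>twist\<close> by an explicit sign on homogeneous series.
\<close>

definition koszul :: "int \<Rightarrow> 'i multiset \<Rightarrow> 'i multiset \<Rightarrow> int" where
  "koszul n p q = inversions p q + wt p * (n - wt q)"

lemma mult_coeff:
  assumes "g \<in> homogeneous n" "monom m"
  shows "(f \<star> g) m = (\<Sum>p | p \<subseteq># m. signed (koszul n p (m - p)) (f p * g (m - p)))"
  using assms
  by (simp add: ps_mult_def twist_homogeneous[OF homogeneous_coeff[OF assms(1)]]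
      koszul_def signed_mult_right signed_signed)

lemma mult_nonmonom: "\<not> monom m \<Longrightarrow> (f \<star> g) m = 0"
  by (simp add: ps_mult_def)

lemma mult_homogeneous:
  assumes f: "f \<in> homogeneous a" and g: "g \<in> homogeneous b"
  shows "f \<star> g \<in> homogeneous (a + b)"
proof (rule homogeneousI)
  fix m assume m: "monom m"
  have "f p * g (m - p) \<in> V (a + b - wt m)" if "p \<subseteq># m" for p
    using mult_degree[OF homogeneous_coeff[OF f, of p] homogeneous_coeff[OF g, of "m - p"]] that
    by (simp add: wt_diff algebra_simps)
  then show "(f \<star> g) m \<in> V (a + b - wt m)"
    unfolding mult_coeff[OF g m]
    by (intro subspace_sum[OF subspace_V] signed_in_V) simp
qed (rule mult_nonmonom)

lemma Delta_homogeneous: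
  assumes "f \<in> homogeneous n"
  shows "ps_Delta f \<in> homogeneous (n - 1)"
proof (rule homogeneousI)
  fix m show "ps_Delta f m \<in> V (n - 1 - wt m)"
    using Delta_degree[OF homogeneous_coeff[OF assms, of m]]
    by (simp add: ps_Delta_def algebra_simps)
qed (simp add: ps_Delta_def homogeneous_nonmonom[OF assms])

text \<open>
  Both sides are sums over \<open>m = p + q + s\<close>, and \<open>koszul\<close> satisfies the cocycle identity on
  the nose, because inversions and weights are additive.
\<close>

lemma mult_assoc:
  assumes g: "g \<in> homogeneous a" and h: "h \<in> homogeneous b"
  shows "(f \<star> g) \<star> h = f \<star> (g \<star> h)"
proof
  fix m
  show "((f \<star> g) \<star> h) m = (f \<star> (g \<star> h)) m"
  proof (cases "monom m")
    case m: True
    note gh = mult_homogeneous[OF g h]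
    have "((f \<star> g) \<star> h) m =
        (\<Sum>p | p \<subseteq># m. \<Sum>q | q \<subseteq># p. signed (koszul b (q + (p - q)) (m - p) + koszul a q (p - q))
           (f q * g (p - q) * h (m - p)))"
      using m monom_subset[OF m]
      by (simp add: mult_coeff[OF h] mult_coeff[OF g] sum_distrib_right signed_mult_left
          signed_sum signed_signed)
    also have "\<dots> = (\<Sum>p | p \<subseteq># m. \<Sum>q | q \<subseteq># m - p.
        signed (koszul b (p + q) (m - p - q) + koszul a p q) (f p * g q * h (m - p - q)))"
      by (rule sum_submultisets_assoc)
    also have "\<dots> = (\<Sum>p | p \<subseteq># m. \<Sum>q | q \<subseteq># m - p.
        signed (koszul (a + b) p (m - p) + koszul b q (m - p - q)) (f p * (g q * h (m - p - q))))"
    proof (intro sum.cong refl)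
      fix p q assume "p \<in> {p. p \<subseteq># m}" "q \<in> {q. q \<subseteq># m - p}"
      then have pq: "p \<subseteq># m" "q \<subseteq># m - p" by auto
      define s where "s = m - p - q"
      have eq: "m - p = q + s" "m = p + q + s"
        using pq by (simp_all only: s_def add.assoc subset_mset.add_diff_inverse)
      have "monom (p + q)" "monom (q + s)"
        using m monom_subset[of m] by (auto simp: eq(2) add.assoc)
      then have "koszul b (p + q) s + koszul a p q = koszul (a + b) p (q + s) + koszul b q s"
        by (simp add: koszul_def inversions_add_left inversions_add_right wt_add algebra_simps)
      then show "signed (koszul b (p + q) (m - p - q) + koszul a p q) (f p * g q * h (m - p - q)) =
          signed (koszul (a + b) p (m - p) + koszul b q (m - p - q)) (f p * (g q * h (m - p - q)))"
        unfolding s_def[symmetric] unfolding eq(1) by (simp only: mult.assoc)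
    qed
    also have "\<dots> = (f \<star> (g \<star> h)) m"
      using m monom_subset[OF m]
      by (simp add: mult_coeff[OF gh] mult_coeff[OF h] sum_distrib_left signed_mult_right
          signed_sum signed_signed)
    finally show ?thesis .
  qed (simp add: mult_nonmonom)
qed

text \<open>
  The sign for exchanging the coefficients, that for exchanging the variables and the two
  contributions to \<open>koszul\<close> cancel: series of total degree zero are central among homogeneous
  ones.
\<close>

lemma mult_commute:
  assumes f: "f \<in> homogeneous 0" and g: "g \<in> homogeneous n"
  shows "f \<star> g = g \<star> f"
proof
  fix m
  show "(f \<star> g) m = (g \<star> f) m"
  proof (cases "monom m")
    case m: True
    have "(f \<star> g) m = (\<Sum>p | p \<subseteq># m. signed (koszul 0 (m - p) p) (g (m - p) * f p))"
      unfolding mult_coeff[OF g m]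
    proof (rule sum.cong[OF refl])
      fix p assume "p \<in> {p. p \<subseteq># m}"
      then have "p + (m - p) = m" by simp
      then have swap: "even (inversions p (m - p) + inversions (m - p) p) \<longleftrightarrow> even (wt p * wt (m - p))"
        using inversions_swap m by metis
      have parity: "even (a + b) = even c \<Longrightarrow> even a = even (b - c)" for a b c :: int
        by presburger
      have "koszul n p (m - p) + (0 - wt p) * (n - wt (m - p)) = inversions p (m - p)"
        "koszul 0 (m - p) p = inversions (m - p) p - wt p * wt (m - p)"
        by (simp_all add: koszul_def algebra_simps)
      then have "even (koszul n p (m - p) + (0 - wt p) * (n - wt (m - p))) \<longleftrightarrow> even (koszul 0 (m - p) p)"
        by (simp only: parity[OF swap])
      then show "signed (koszul n p (m - p)) (f p * g (m - p)) =
          signed (koszul 0 (m - p) p) (g (m - p) * f p)"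
        using graded_commute[OF homogeneous_coeff[OF f, of p] homogeneous_coeff[OF g, of "m - p"]]
        by (simp only: signed_signed) (rule signed_cong)
    qed
    also have "\<dots> = (g \<star> f) m"
      unfolding mult_coeff[OF f m] by (rule sum_submultisets_flip[symmetric])
    finally show ?thesis .
  qed (simp add: mult_nonmonom)
qed

text \<open>
  For a closed \<open>X\<close> of total degree zero this is the extended bracket \<open>[X, f]\<close>: the term with
  \<open>\<Delta> X\<close> vanishes and the parity sign is trivial.
\<close>

definition bracket :: "('i multiset \<Rightarrow> 'v) \<Rightarrow> ('i multiset \<Rightarrow> 'v) \<Rightarrow> 'i multiset \<Rightarrow> 'v" where
  "bracket X f m = \<Delta> ((X \<star> f) m) - (X \<star> ps_Delta f) m"

text \<open>
  With a closed first argument, the bracket of power series is the bracket of coefficients with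
  the same signs as the product: the sign \<open>- wt p\<close> in the definition of the coefficient bracket
  is the one by which \<open>koszul (-1)\<close> and \<open>koszul 0\<close> differ.
\<close>

lemma bracket_coeff:
  assumes X: "\<And>m. \<Delta> (X m) = 0" and f: "f \<in> homogeneous 0" and m: "monom m"
  shows "bracket X f m =
    (\<Sum>p | p \<subseteq># m. signed (koszul 0 p (m - p)) (bv_bracket \<Delta> (- wt p) (X p) (f (m - p))))"
proof -
  have sgn: "signed (koszul (- 1) p q) v = signed (koszul 0 p q) (signed (- wt p) v)" for p q and v :: 'v
    unfolding signed_signed by (rule signed_cong) (auto simp: koszul_def)
  show ?thesis
    using mult_coeff[OF f m] mult_coeff[OF Delta_homogeneous[OF f] m]
    by (simp add: bracket_def Delta.sum Delta_signed sgn ps_Delta_def bv_bracket_def X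
        flip: sum_subtractf signed_minus)
qed

lemma bracket_homogeneous:
  assumes "X \<in> homogeneous 0" "f \<in> homogeneous 0"
  shows "bracket X f \<in> homogeneous (- 1)"
proof (rule homogeneousI)
  fix m
  show "bracket X f m \<in> V (- 1 - wt m)"
    using homogeneous_coeff[OF Delta_homogeneous[OF mult_homogeneous[OF assms]], of m]
      homogeneous_coeff[OF mult_homogeneous[OF assms(1) Delta_homogeneous[OF assms(2)]], of m]
    by (simp add: bracket_def ps_Delta_def subspace_diff[OF subspace_V])
qed (simp add: bracket_def mult_nonmonom)

text \<open>
  The derivation property of the brackets of coefficients carries over to power series. Its sign
  for moving \<open>[X\<^sub>p, -]\<close> past \<open>f\<^sub>q\<close> is compensated by the reordering of \<open>t\<^sup>p\<close> and \<open>t\<^sup>q\<close>.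
\<close>

lemma bracket_mult:
  assumes X: "X \<in> homogeneous 0" "\<And>m. \<Delta> (X m) = 0"
    and f: "f \<in> homogeneous 0" and g: "g \<in> homogeneous 0" and m: "monom m"
  shows "bracket X (f \<star> g) m = (bracket X f \<star> g) m + (f \<star> bracket X g) m"
proof -
  have fg: "f \<star> g \<in> homogeneous 0"
    using mult_homogeneous[OF f g] by simp
  let ?br = "\<lambda>p. bv_bracket \<Delta> (- wt p) (X p)"
  have "bracket X (f \<star> g) m = (\<Sum>p | p \<subseteq># m. \<Sum>q | q \<subseteq># m - p.
      signed (koszul 0 p (m - p) + koszul 0 q (m - p - q)) (?br p (f q * g (m - p - q))))"
    using m monom_subset[OF m]
    by (simp add: bracket_coeff[OF X(2) fg] mult_coeff[OF g] bv_bracket_sum bv_bracket_signed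
        signed_sum signed_signed)
  also have "\<dots> = (\<Sum>p | p \<subseteq># m. \<Sum>q | q \<subseteq># m - p.
        signed (koszul 0 (p + q) (m - p - q) + koszul 0 p q) (?br p (f q) * g (m - p - q)) +
        signed (koszul (- 1) q (p + (m - p - q)) + koszul 0 p (m - p - q))
          (f q * ?br p (g (m - p - q))))"
  proof (intro sum.cong refl)
    fix p q assume "p \<in> {p. p \<subseteq># m}" "q \<in> {q. q \<subseteq># m - p}"
    then have pq: "p \<subseteq># m" "q \<subseteq># m - p" by auto
    define s where "s = m - p - q"
    have eq: "m - p = q + s" "m = p + q + s"
      using pq by (simp_all only: s_def add.assoc subset_mset.add_diff_inverse)
    have mon: "monom (p + q)" "monom (q + s)" "monom (p + s)"
      using m monom_subset[of m] by (auto simp: eq(2) add.assoc)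
    have "koszul 0 p (q + s) + koszul 0 q s = koszul 0 (p + q) s + koszul 0 p q"
      using mon
      by (simp add: koszul_def inversions_add_left inversions_add_right wt_add algebra_simps)
    moreover have "even (koszul 0 p (q + s) + koszul 0 q s + (- wt p - 1) * (- wt q)) \<longleftrightarrow>
        even (koszul (- 1) q (p + s) + koszul 0 p s)"
    proof -
      have "koszul 0 p (q + s) + koszul 0 q s + (- wt p - 1) * (- wt q) =
          koszul (- 1) q (p + s) + koszul 0 p s +
          (inversions p q + inversions q p + wt p * wt q) + 2 * (wt q - inversions q p)"
        using mon
        by (simp add: koszul_def inversions_add_left inversions_add_right wt_add algebra_simps)
      moreover have "even (inversions p q + inversions q p + wt p * wt q)"
        using inversions_swap[OF mon(1)] by presburger
      ultimately show ?thesis by (metis dvd_add_left_iff dvd_triv_left)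
    qed
    moreover have "?br p (f q * g s) = ?br p (f q) * g s +
        signed ((- wt p - 1) * (- wt q)) (f q * ?br p (g s))"
      using bracket_derivation[of "X p" "- wt p" "f q" "- wt q" "g s"]
        homogeneous_coeff[OF X(1), of p] homogeneous_coeff[OF f, of q] by simp
    ultimately show "signed (koszul 0 p (m - p) + koszul 0 q (m - p - q)) (?br p (f q * g (m - p - q))) =
        signed (koszul 0 (p + q) (m - p - q) + koszul 0 p q) (?br p (f q) * g (m - p - q)) +
        signed (koszul (- 1) q (p + (m - p - q)) + koszul 0 p (m - p - q))
          (f q * ?br p (g (m - p - q)))"
      unfolding s_def[symmetric] unfolding eq(1)
      by (simp only: signed_add signed_signed) (rule arg_cong2[where f = "(+)"], rule refl, rule signed_cong)
  qed
  also have "\<dots> =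
      (\<Sum>p | p \<subseteq># m. \<Sum>q | q \<subseteq># m - p.
        signed (koszul 0 (p + q) (m - p - q) + koszul 0 p q) (?br p (f q) * g (m - p - q))) +
      (\<Sum>p | p \<subseteq># m. \<Sum>q | q \<subseteq># m - p.
        signed (koszul (- 1) q (p + (m - p - q)) + koszul 0 p (m - p - q))
          (f q * ?br p (g (m - p - q))))"
    by (simp add: sum.distrib)
  also have "(\<Sum>p | p \<subseteq># m. \<Sum>q | q \<subseteq># m - p.
        signed (koszul 0 (p + q) (m - p - q) + koszul 0 p q) (?br p (f q) * g (m - p - q))) =
      (\<Sum>p | p \<subseteq># m. \<Sum>q | q \<subseteq># p.
        signed (koszul 0 (q + (p - q)) (m - p) + koszul 0 q (p - q)) (?br q (f (p - q)) * g (m - p)))"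
    by (rule sum_submultisets_assoc[symmetric])
  also have "\<dots> = (bracket X f \<star> g) m"
    using m monom_subset[OF m]
    by (simp add: bracket_coeff[OF X(2) f] mult_coeff[OF g] sum_distrib_right signed_mult_left
        signed_sum signed_signed)
  also have "(\<Sum>p | p \<subseteq># m. \<Sum>q | q \<subseteq># m - p.
        signed (koszul (- 1) q (p + (m - p - q)) + koszul 0 p (m - p - q))
          (f q * ?br p (g (m - p - q)))) =
      (\<Sum>q | q \<subseteq># m. \<Sum>p | p \<subseteq># m - q.
        signed (koszul (- 1) q (p + (m - q - p)) + koszul 0 p (m - q - p))
          (f q * ?br p (g (m - q - p))))"
    by (rule sum_submultisets_swap)
  also have "\<dots> = (\<Sum>q | q \<subseteq># m. \<Sum>p | p \<subseteq># m - q.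
        signed (koszul (- 1) q (m - q) + koszul 0 p (m - q - p)) (f q * ?br p (g (m - q - p))))"
    by (intro sum.cong refl) (simp only: mem_Collect_eq subset_mset.add_diff_inverse)
  also have "\<dots> = (f \<star> bracket X g) m"
    using m monom_subset[OF m]
    by (simp add: bracket_coeff[OF X(2) g] mult_coeff[OF bracket_homogeneous[OF X(1) g]]
        sum_distrib_left signed_mult_right signed_sum signed_signed)
  finally show ?thesis .
qed

end

section \<open>Powers and the logarithm\<close>

lemma choose_two_add: "(a + b) choose 2 = (a choose 2) + (b choose 2) + a * b"
  by (induction a) (simp_all add: numeral_2_eq_2)

context bv_power_series
begin

lemma twist_zero [simp]: "twist n 0 = 0"
  using twist_homogeneous[OF zero_in_V, of n 0] by simp

lemma mult_zero_right [simp]: "f \<star> (\<lambda>_. 0) = (\<lambda>_. 0)"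
  by (simp add: ps_mult_def fun_eq_iff)

text \<open>
  The product at \<open>m\<close> only involves coefficients at submultisets of \<open>m\<close>, so the factors may be
  replaced by any expansions valid there. This is how an infinite series such as the logarithm is
  multiplied out as a finite sum.
\<close>

lemma mult_sum:
  assumes g: "g \<in> homogeneous n" and G: "\<And>b. G b \<in> homogeneous n" and m: "monom m"
    and f_sum: "\<And>p. p \<subseteq># m \<Longrightarrow> f p = (\<Sum>a\<in>A. scale (c a) (F a p))"
    and g_sum: "\<And>p. p \<subseteq># m \<Longrightarrow> g p = (\<Sum>b\<in>B. scale (d b) (G b p))"
  shows "(f \<star> g) m = (\<Sum>a\<in>A. \<Sum>b\<in>B. scale (c a * d b) ((F a \<star> G b) m))"
proof -
  have "(f \<star> g) m = (\<Sum>p | p \<subseteq># m. \<Sum>a\<in>A. \<Sum>b\<in>B.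
      scale (c a * d b) (signed (koszul n p (m - p)) (F a p * G b (m - p))))"
    unfolding mult_coeff[OF g m]
  proof (rule sum.cong[OF refl])
    fix p assume "p \<in> {p. p \<subseteq># m}"
    then have "f p * g (m - p) = (\<Sum>a\<in>A. \<Sum>b\<in>B. scale (c a * d b) (F a p * G b (m - p)))"
      by (simp add: f_sum g_sum sum_product scale_mult_left scale_mult_right mult.commute)
    then show "signed (koszul n p (m - p)) (f p * g (m - p)) = (\<Sum>a\<in>A. \<Sum>b\<in>B.
        scale (c a * d b) (signed (koszul n p (m - p)) (F a p * G b (m - p))))"
      by (simp add: signed_sum scale_signed)
  qed
  also have "\<dots> = (\<Sum>a\<in>A. \<Sum>p | p \<subseteq># m. \<Sum>b\<in>B.
      scale (c a * d b) (signed (koszul n p (m - p)) (F a p * G b (m - p))))"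
    by (rule sum.swap)
  also have "\<dots> = (\<Sum>a\<in>A. \<Sum>b\<in>B. \<Sum>p | p \<subseteq># m.
      scale (c a * d b) (signed (koszul n p (m - p)) (F a p * G b (m - p))))"
    by (rule sum.cong[OF refl]) (rule sum.swap)
  finally show ?thesis
    by (simp add: mult_coeff[OF G m] scale_sum_right)
qed

lemma scale_homogeneous:
  "f \<in> homogeneous n \<Longrightarrow> (\<lambda>m. scale c (f m)) \<in> homogeneous n"
  by (rule homogeneousI)
     (simp_all add: homogeneous_nonmonom subspace_scale[OF subspace_V] homogeneous_coeff)

lemma mult_scale_right:
  assumes "g \<in> homogeneous n"
  shows "(f \<star> (\<lambda>m. scale c (g m))) m = scale c ((f \<star> g) m)"
proof (cases "monom m")
  case True
  show ?thesis
    using mult_sum[where A = "{()}" and B = "{()}" and F = "\<lambda>_. f" and G = "\<lambda>_. g" and f = f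
      and c = "\<lambda>_. 1" and d = "\<lambda>_. c", OF scale_homogeneous[OF assms, of c] assms True] by simp
qed (simp add: mult_nonmonom)

lemma mult_support:
  assumes "\<And>p. f p \<noteq> 0 \<Longrightarrow> size p = a" "\<And>q. g q \<noteq> 0 \<Longrightarrow> size q = b"
    and "(f \<star> g) m \<noteq> 0"
  shows "size m = a + b"
proof -
  have "\<exists>p. p \<subseteq># m \<and> f p \<noteq> 0 \<and> g (m - p) \<noteq> 0"
  proof (rule ccontr)
    assume "\<nexists>p. p \<subseteq># m \<and> f p \<noteq> 0 \<and> g (m - p) \<noteq> 0"
    then have "f p * twist (wt p) (g (m - p)) = 0" if "p \<subseteq># m" for p
      using that by (cases "f p = 0") auto
    then have "(f \<star> g) m = 0"
      by (simp add: ps_mult_def)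
    with assms(3) show False ..
  qed
  then obtain p where p: "p \<subseteq># m" "f p \<noteq> 0" "g (m - p) \<noteq> 0" by blast
  have "size p + size (m - p) = size m"
    using p(1) by (metis size_union subset_mset.add_diff_inverse)
  then show ?thesis using assms(1)[OF p(2)] assms(2)[OF p(3)] by simp
qed

definition one :: "'i multiset \<Rightarrow> 'v" where
  "one m = (if m = {#} then u else 0)"

lemma one_homogeneous: "one \<in> homogeneous 0"
  by (rule homogeneousI) (auto simp: one_def zero_in_V unit_degree monomial_degree_def monomial_def)

lemma one_mult:
  assumes "f \<in> homogeneous n"
  shows "one \<star> f = f"
proof
  fix m
  show "(one \<star> f) m = f m"
  proof (cases "monom m")
    case m: True
    have "koszul n {#} m = 0"
      by (simp add: koszul_def odd_inversions_def monomial_degree_def)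
    then have "signed (koszul n p (m - p)) (one p * f (m - p)) = (if p = {#} then f m else 0)" for p
      by (simp add: one_def unit_left signed_def)
    then show ?thesis
      by (simp add: mult_coeff[OF assms m] finite_submultisets)
  qed (simp add: mult_nonmonom homogeneous_nonmonom[OF assms])
qed

primrec pow :: "('i multiset \<Rightarrow> 'v) \<Rightarrow> nat \<Rightarrow> 'i multiset \<Rightarrow> 'v" where
  "pow X 0 = one"
| "pow X (Suc n) = X \<star> pow X n"

text \<open>
  The series \<open>log (1 + X) = \<Sum>\<^sub>n (-1)\<^sup>n\<^sup>+\<^sup>1 X\<^sup>n / n\<close> for \<open>X\<close> linear in the variables. Then
  \<open>X\<^sup>n\<close> is homogeneous of polynomial degree \<open>n\<close>, and a single power contributes to each
  coefficient. The constant term vanishes because \<open>x / 0 = 0\<close>.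
\<close>

definition logarithm :: "('i multiset \<Rightarrow> 'v) \<Rightarrow> 'i multiset \<Rightarrow> 'v" where
  "logarithm X m = scale ((- 1) ^ Suc (size m) / of_nat (size m)) (pow X (size m) m)"

context
  fixes X
  assumes X: "X \<in> homogeneous 0" and closed: "ps_Delta X = (\<lambda>_. 0)"
    and linear: "\<And>m. X m \<noteq> 0 \<Longrightarrow> size m = 1"
begin

lemma pow_homogeneous: "pow X n \<in> homogeneous 0"
  using mult_homogeneous[OF X] by (induction n) (auto simp: one_homogeneous)

lemma pow_mult: "pow X a \<star> pow X b = pow X (a + b)"
  by (induction a) (simp_all add: one_mult[OF pow_homogeneous] mult_assoc[OF pow_homogeneous pow_homogeneous])

lemma pow_support: "pow X n m \<noteq> 0 \<Longrightarrow> size m = n"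
proof (induction n arbitrary: m)
  case (Suc n)
  then show ?case using mult_support[where f = X and g = "pow X n" and a = 1 and b = n and m = m] linear by simp
qed (simp add: one_def split: if_splits)

lemma mult_one: "X \<star> one = X"
  using mult_commute[OF X one_homogeneous] one_mult[OF X] by simp

lemma pow_one: "pow X 1 = X"
  by (simp add: mult_one)

text \<open>
  The series \<open>X\<^sup>n [X, X]\<close>; for closed \<open>X\<close> the bracket \<open>[X, X]\<close> is \<open>\<Delta> (X\<^sup>2)\<close>.
\<close>

definition pow_self_bracket :: "nat \<Rightarrow> 'i multiset \<Rightarrow> 'v" where
  "pow_self_bracket n = pow X n \<star> ps_Delta (X \<star> X)"

lemma square_homogeneous: "ps_Delta (X \<star> X) \<in> homogeneous (- 1)"
  using Delta_homogeneous[OF mult_homogeneous[OF X X]] by simp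

lemma pow_self_bracket_homogeneous: "pow_self_bracket n \<in> homogeneous (- 1)"
  unfolding pow_self_bracket_def using mult_homogeneous[OF pow_homogeneous square_homogeneous] by simp

lemma pow_self_bracket_support: "pow_self_bracket n m \<noteq> 0 \<Longrightarrow> size m = n + 2"
  unfolding pow_self_bracket_def
proof (rule mult_support[OF pow_support])
  fix q assume "ps_Delta (X \<star> X) q \<noteq> 0"
  then have "(X \<star> X) q \<noteq> 0" by (auto simp: ps_Delta_def)
  then show "size q = 2" using mult_support[where f = X and g = X and a = 1 and b = 1 and m = q] linear by simp
qed

lemma pow_mult_pow_self_bracket: "pow X a \<star> pow_self_bracket b = pow_self_bracket (a + b)"
  unfolding pow_self_bracket_def
  by (simp add: mult_assoc[OF pow_homogeneous square_homogeneous, symmetric] pow_mult)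

lemma mult_pow_self_bracket: "X \<star> pow_self_bracket b = pow_self_bracket (Suc b)"
  using pow_mult_pow_self_bracket[of 1 b] by (simp add: mult_one)

lemma Delta_one: "ps_Delta one = (\<lambda>_. 0)"
  by (simp add: ps_Delta_def one_def fun_eq_iff Delta_unit)

text \<open>
  The power rule for the derivation \<open>[X, -]\<close>. The truncated exponent \<open>n - 1\<close> is harmless at
  \<open>n = 0\<close>, where the coefficient vanishes; similarly for \<open>n - 2\<close> in the next lemmas.
\<close>

lemma bracket_pow: "bracket X (pow X n) = (\<lambda>m. scale (of_nat n) (pow_self_bracket (n - 1) m))"
proof (induction n)
  case 0
  show ?case
    using closed by (simp add: bracket_def Delta_one mult_one fun_eq_iff ps_Delta_def)
next
  case (Suc n)
  have X': "\<Delta> (X m) = 0" for m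
    using closed by (simp add: ps_Delta_def fun_eq_iff)
  show ?case
  proof
    fix m
    show "bracket X (pow X (Suc n)) m = scale (of_nat (Suc n)) (pow_self_bracket (Suc n - 1) m)"
    proof (cases "monom m")
      case m: True
      have "bracket X X = ps_Delta (X \<star> X)"
        by (simp add: bracket_def closed ps_Delta_def fun_eq_iff)
      then have "(bracket X X \<star> pow X n) m = pow_self_bracket n m"
        using mult_commute[OF pow_homogeneous square_homogeneous] by (simp add: pow_self_bracket_def)
      moreover have "(X \<star> bracket X (pow X n)) m = scale (of_nat n) (pow_self_bracket n m)"
        unfolding Suc mult_scale_right[OF pow_self_bracket_homogeneous] mult_pow_self_bracket
        by (cases n) simp_all
      ultimately show ?thesis
        using bracket_mult[OF X X' X pow_homogeneous m, of n]
        by (simp add: scale_left_distrib)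
    qed (simp add: bracket_def mult_nonmonom homogeneous_nonmonom[OF pow_self_bracket_homogeneous])
  qed
qed

text \<open>
  Induction from \<open>\<Delta> (X X\<^sup>n) = [X, X\<^sup>n] + X \<Delta> X\<^sup>n\<close>, with coefficients adding up by Pascal's rule
  \<open>n + (n choose 2) = (n + 1 choose 2)\<close>.
\<close>

lemma Delta_pow: "ps_Delta (pow X n) = (\<lambda>m. scale (of_nat (n choose 2)) (pow_self_bracket (n - 2) m))"
proof (induction n)
  case 0
  show ?case by (simp add: Delta_one binomial_eq_0)
next
  case (Suc n)
  show ?case
  proof
    fix m
    have "(X \<star> ps_Delta (pow X n)) m = scale (of_nat (n choose 2)) (pow_self_bracket (n - 1) m)"
      unfolding Suc mult_scale_right[OF pow_self_bracket_homogeneous] mult_pow_self_bracket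
      by (cases "n < 2") (auto simp: Suc_diff_Suc numeral_2_eq_2 less_Suc_eq)
    moreover have "ps_Delta (pow X (Suc n)) m = bracket X (pow X n) m + (X \<star> ps_Delta (pow X n)) m"
      by (simp add: bracket_def ps_Delta_def)
    ultimately show "ps_Delta (pow X (Suc n)) m =
        scale (of_nat (Suc n choose 2)) (pow_self_bracket (Suc n - 2) m)"
      by (simp add: bracket_pow numeral_2_eq_2 scale_left_distrib)
  qed
qed

text \<open>
  The bracket measures the failure of \<open>\<Delta>\<close> to be a derivation; by \<open>Delta_pow\<close> it is
  governed by \<open>(a + b choose 2) - (a choose 2) - (b choose 2) = a b\<close>.
\<close>

lemma bracket_pow_pow:
  "\<Delta> ((pow X a \<star> pow X b) m) - (ps_Delta (pow X a) \<star> pow X b) m - (pow X a \<star> ps_Delta (pow X b)) m =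
   scale (of_nat (a * b)) (pow_self_bracket (a + b - 2) m)"
proof -
  have right: "(pow X a \<star> ps_Delta (pow X b)) m = scale (of_nat (b choose 2)) (pow_self_bracket (a + b - 2) m)"
    for a b
    unfolding Delta_pow mult_scale_right[OF pow_self_bracket_homogeneous] pow_mult_pow_self_bracket
    by (cases "b < 2") (auto simp: binomial_eq_0)
  have "(ps_Delta (pow X a) \<star> pow X b) m = scale (of_nat (a choose 2)) (pow_self_bracket (a + b - 2) m)"
    using right[of b a] mult_commute[OF pow_homogeneous Delta_homogeneous[OF pow_homogeneous]]
    by (simp add: add.commute)
  moreover have "\<Delta> ((pow X a \<star> pow X b) m) =
      scale (of_nat ((a + b) choose 2)) (pow_self_bracket (a + b - 2) m)"
    using fun_cong[OF Delta_pow[of "a + b"], of m] by (simp add: pow_mult ps_Delta_def)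
  ultimately show ?thesis
    by (simp add: right choose_two_add scale_left_distrib)
qed

lemma logarithm_homogeneous: "logarithm X \<in> homogeneous 0"
proof (rule homogeneousI)
  fix m show "logarithm X m \<in> V (0 - wt m)"
    unfolding logarithm_def
    by (rule subspace_scale[OF subspace_V homogeneous_coeff[OF pow_homogeneous]])
qed (simp add: logarithm_def homogeneous_nonmonom[OF pow_homogeneous])

lemma logarithm_sum:
  assumes "size p \<le> N"
  shows "logarithm X p = (\<Sum>a\<le>N. scale ((- 1) ^ Suc a / of_nat a) (pow X a p))"
proof -
  have "scale ((- 1) ^ Suc a / of_nat a) (pow X a p) = (if a = size p then logarithm X p else 0)" for a
    using pow_support[of a p] by (auto simp: logarithm_def)
  then show ?thesis using assms by simp
qed

lemma ps_parity_even:
  assumes "f \<in> homogeneous 0"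
  shows "ps_parity deg f = f"
proof
  fix m
  show "ps_parity deg f m = f m"
    unfolding ps_parity_def twist_homogeneous[OF homogeneous_coeff[OF assms]] signed_signed
    by (simp add: signed_def)
qed

text \<open>
  The coefficients \<open>(-1)\<^sup>a\<^sup>+\<^sup>1 / a\<close> and \<open>(-1)\<^sup>b\<^sup>+\<^sup>1 / b\<close> of the logarithm cancel the factor \<open>a b\<close> in
  \<open>[X\<^sup>a, X\<^sup>b]\<close>, so \<open>[\<Gamma>, \<Gamma>]\<close> at a monomial \<open>m\<close> of size \<open>N\<close> merely counts the pairs
  \<open>a + b = N\<close> of positive numbers.
\<close>

lemma maurer_cartan_logarithm: "maurer_cartan I deg r (logarithm X)"
  unfolding maurer_cartan_def
proof
  fix m :: "'i multiset"
  let ?G = "logarithm X" and ?N = "size m"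
  let ?c = "\<lambda>a. (- 1) ^ Suc a / of_nat a :: 'k"
  let ?Y = "pow_self_bracket (?N - 2) m"
  show "ps_Delta ?G m + scale (1 / 2) (ps_bracket I deg r ?G ?G m) = 0"
  proof (cases "monom m")
    case m: True
    have G: "?G p = (\<Sum>a\<le>?N. scale (?c a) (pow X a p))" if "p \<subseteq># m" for p
      using logarithm_sum[of p ?N] size_mset_mono[OF that] by simp
    then have DG: "ps_Delta ?G p = (\<Sum>a\<le>?N. scale (?c a) (ps_Delta (pow X a) p))" if "p \<subseteq># m" for p
      by (simp only: ps_Delta_def G[OF that] Delta.sum Delta.scale)
    note hom = logarithm_homogeneous pow_homogeneous
    have GG: "(?G \<star> ?G) m = (\<Sum>a\<le>?N. \<Sum>b\<le>?N. scale (?c a * ?c b) ((pow X a \<star> pow X b) m))"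
      by (rule mult_sum[OF hom m G G])
    have DGG: "(ps_Delta ?G \<star> ?G) m =
        (\<Sum>a\<le>?N. \<Sum>b\<le>?N. scale (?c a * ?c b) ((ps_Delta (pow X a) \<star> pow X b) m))"
      by (rule mult_sum[OF hom m DG G])
    have GDG: "(?G \<star> ps_Delta ?G) m =
        (\<Sum>a\<le>?N. \<Sum>b\<le>?N. scale (?c a * ?c b) ((pow X a \<star> ps_Delta (pow X b)) m))"
      by (rule mult_sum[OF hom[THEN Delta_homogeneous] m G DG])
    have "ps_bracket I deg r ?G ?G m = (\<Sum>a\<le>?N. \<Sum>b\<le>?N. scale (?c a * ?c b)
        (\<Delta> ((pow X a \<star> pow X b) m) - (ps_Delta (pow X a) \<star> pow X b) m -
          (pow X a \<star> ps_Delta (pow X b)) m))"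
      unfolding ps_bracket_def ps_parity_even[OF logarithm_homogeneous]
        ps_Delta_def[of "?G \<star> ?G"] GG DGG GDG
      by (simp only: Delta.sum Delta.scale scale_right_diff_distrib sum_subtractf)
    also have "\<dots> = (\<Sum>a\<le>?N. \<Sum>b\<le>?N. if b = ?N - a then
        if a \<in> {0<..<?N} then scale ((- 1) ^ ?N) ?Y else 0 else 0)"
    proof (intro sum.cong refl)
      fix a b assume ab: "a \<in> {..?N}" "b \<in> {..?N}"
      have "scale (?c a * ?c b) (scale (of_nat (a * b)) (pow_self_bracket (a + b - 2) m)) =
          (if b = ?N - a then if a \<in> {0<..<?N} then scale ((- 1) ^ ?N) ?Y else 0 else 0)"
      proof (cases "a = 0 \<or> b = 0")
        case True
        then show ?thesis using ab by auto
      next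
        case False
        then have "?c a * ?c b * of_nat (a * b) = (- 1) ^ (a + b)"
          by (simp add: power_add)
        then have *: "scale (?c a * ?c b) (scale (of_nat (a * b)) (pow_self_bracket (a + b - 2) m)) =
            scale ((- 1) ^ (a + b)) (pow_self_bracket (a + b - 2) m)"
          by simp
        \<comment> \<open>Polynomial degree: only the terms with \<open>a + b\<close> equal to the size of \<open>m\<close> survive.\<close>
        have "pow_self_bracket (a + b - 2) m = 0" if "a + b \<noteq> ?N"
          using pow_self_bracket_support[of "a + b - 2" m] that False by linarith
        then show ?thesis
          unfolding * using False ab by auto
      qed
      then show "scale (?c a * ?c b) (\<Delta> ((pow X a \<star> pow X b) m) -
          (ps_Delta (pow X a) \<star> pow X b) m - (pow X a \<star> ps_Delta (pow X b)) m) =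
          (if b = ?N - a then if a \<in> {0<..<?N} then scale ((- 1) ^ ?N) ?Y else 0 else 0)"
        unfolding bracket_pow_pow .
    qed
    also have "\<dots> = (\<Sum>a\<le>?N. if a \<in> {0<..<?N} then scale ((- 1) ^ ?N) ?Y else 0)"
      by (simp add: sum.delta)
    also have "\<dots> = (\<Sum>a\<in>{0<..<?N}. scale ((- 1) ^ ?N) ?Y)"
      by (rule sum.mono_neutral_cong_right) auto
    also have "\<dots> = scale (of_nat (?N - 1) * (- 1) ^ ?N) ?Y"
      by (simp add: sum_constant_scale)
    finally have br: "ps_bracket I deg r ?G ?G m = scale (of_nat (?N - 1) * (- 1) ^ ?N) ?Y" .
    have "ps_Delta ?G m = scale (?c ?N) (ps_Delta (pow X ?N) m)"
      by (simp only: ps_Delta_def logarithm_def Delta.scale)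
    also have "\<dots> = scale (?c ?N * of_nat (?N choose 2)) ?Y"
      by (simp add: Delta_pow)
    also have "?c ?N * of_nat (?N choose 2) = - (1 / 2 * (of_nat (?N - 1) * (- 1) ^ ?N))"
    proof (cases ?N)
      case (Suc n)
      have "2 * (Suc n choose 2) = Suc n * n"
        by (simp add: choose_two)
      then have "2 * of_nat (Suc n choose 2) = (of_nat (Suc n) * of_nat n :: 'k)"
        by (metis of_nat_mult of_nat_numeral)
      moreover have "(of_nat (Suc n) :: 'k) \<noteq> 0" by (rule of_nat_neq_0)
      ultimately show ?thesis unfolding Suc by (simp add: field_simps del: of_nat_Suc)
    qed simp
    finally show ?thesis
      unfolding br by (simp add: scale_minus_left)
  qed (simp add: ps_bracket_def mult_nonmonom ps_Delta_def homogeneous_nonmonom[OF logarithm_homogeneous])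
qed

end

end

section \<open>A homogeneous basis of the homology\<close>

context bv_algebra
begin

lemma mem_coset_iff: "x \<in> {v} + range \<Delta> \<longleftrightarrow> x - v \<in> range \<Delta>"
  by (force simp: set_plus_def algebra_simps image_iff)

lemma subspace_range_Delta: "subspace (range \<Delta>)"
  using Delta.subspace_image[OF subspace_UNIV] .

lemma coset_eq_iff: "{v} + range \<Delta> = {w} + range \<Delta> \<longleftrightarrow> v - w \<in> range \<Delta>"
proof
  assume "{v} + range \<Delta> = {w} + range \<Delta>"
  moreover have "v \<in> {v} + range \<Delta>"
    by (simp add: mem_coset_iff subspace_0[OF subspace_range_Delta])
  ultimately show "v - w \<in> range \<Delta>"
    by (simp add: mem_coset_iff)
next
  assume vw: "v - w \<in> range \<Delta>"
  have "x - v \<in> range \<Delta> \<longleftrightarrow> x - w \<in> range \<Delta>" for x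
    using subspace_add[OF subspace_range_Delta, of "x - v" "v - w"]
      subspace_diff[OF subspace_range_Delta, of "x - w" "v - w"] vw by auto
  then show "{v} + range \<Delta> = {w} + range \<Delta>"
    by (auto simp: mem_coset_iff)
qed

lemma range_Delta_add_scaled_coset:
  "{w} + range \<Delta> + scale a ` ({v} + range \<Delta>) = {w + scale a v} + range \<Delta>"
proof (rule set_eqI)
  note sub = subspace_range_Delta
  fix x
  show "x \<in> {w} + range \<Delta> + scale a ` ({v} + range \<Delta>) \<longleftrightarrow> x \<in> {w + scale a v} + range \<Delta>"
  proof
    assume "x \<in> {w} + range \<Delta> + scale a ` ({v} + range \<Delta>)"
    then obtain y z where x: "x = y + scale a z" and y: "y - w \<in> range \<Delta>" and z: "z - v \<in> range \<Delta>"
      unfolding set_plus_def[of "{w} + range \<Delta>"] by (auto simp: mem_coset_iff)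
    have "x - (w + scale a v) = (y - w) + scale a (z - v)"
      by (simp add: x scale_right_diff_distrib)
    also have "\<dots> \<in> range \<Delta>"
      using subspace_add[OF sub y subspace_scale[OF sub z]] .
    finally show "x \<in> {w + scale a v} + range \<Delta>"
      unfolding mem_coset_iff .
  next
    assume x: "x \<in> {w + scale a v} + range \<Delta>"
    have "x - scale a v \<in> {w} + range \<Delta>"
      using x unfolding mem_coset_iff by (simp add: algebra_simps)
    moreover have "scale a v \<in> scale a ` ({v} + range \<Delta>)"
      by (rule imageI) (simp add: mem_coset_iff subspace_0[OF sub])
    ultimately have "(x - scale a v) + scale a v \<in> {w} + range \<Delta> + scale a ` ({v} + range \<Delta>)"
      by (rule set_plus_intro)
    then show "x \<in> {w} + range \<Delta> + scale a ` ({v} + range \<Delta>)"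
      by simp
  qed
qed

text \<open>
  A combination of cosets is the coset of the combination of any representatives. A vanishing
  coefficient scales a coset to \<open>{0}\<close>, which the summand \<open>range \<Delta>\<close> absorbs.
\<close>

lemma class_comb_eq:
  assumes "finite F" "\<And>b. b \<in> F \<Longrightarrow> b = {\<gamma> b} + range \<Delta>"
  shows "class_comb c F = {\<Sum>b\<in>F. scale (c b) (\<gamma> b)} + range \<Delta>"
  using assms
proof (induction F)
  case empty
  then show ?case by (simp add: class_comb_def flip: set_zero)
next
  case (insert b F)
  have "class_comb c (insert b F) = class_comb c F + scale (c b) ` b"
    using insert.hyps by (simp add: class_comb_def add.assoc add.commute add.left_commute)
  also have "\<dots> = ({\<Sum>b\<in>F. scale (c b) (\<gamma> b)} + range \<Delta>) + scale (c b) ` ({\<gamma> b} + range \<Delta>)"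
    using insert.IH insert.prems by (metis insertCI)
  finally show ?case
    unfolding range_Delta_add_scaled_coset
    using insert.hyps by (simp add: add.commute[of "scale (c b) (\<gamma> b)"])
qed

text \<open>
  As \<open>\<Delta>\<close> shifts degrees by one, the images of the components of \<open>v\<close> are, up to a shift, the
  components of \<open>\<Delta> v = 0\<close>, hence zero by uniqueness.
\<close>

lemma cycle_sum_homogeneous_cycles:
  assumes "\<Delta> v = 0"
  shows "v \<in> span {w. \<Delta> w = 0 \<and> (\<exists>j. w \<in> V j)}"
proof -
  obtain c where c: "is_decomposition V v c"
    using direct_sum by blast
  then have cV: "\<And>j. c j \<in> V j" and fin: "finite {j. c j \<noteq> 0}" and v: "v = (\<Sum>j | c j \<noteq> 0. c j)"
    by (auto simp: is_decomposition_def)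
  let ?d = "\<lambda>j. \<Delta> (c (j + 1))"
  have sub: "{j. ?d j \<noteq> 0} \<subseteq> (\<lambda>j. j - 1) ` {j. c j \<noteq> 0}"
  proof
    fix j assume "j \<in> {j. ?d j \<noteq> 0}"
    then have "j + 1 \<in> {j. c j \<noteq> 0}" by auto
    then show "j \<in> (\<lambda>j. j - 1) ` {j. c j \<noteq> 0}"
      by (rule rev_image_eqI) simp
  qed
  have "(\<Sum>j | ?d j \<noteq> 0. ?d j) = (\<Sum>j\<in>(\<lambda>j. j - 1) ` {j. c j \<noteq> 0}. ?d j)"
    using sub fin by (intro sum.mono_neutral_left) auto
  also have "\<dots> = \<Delta> v"
    by (simp add: sum.reindex inj_on_def v Delta.sum)
  finally have "is_decomposition V 0 ?d"
    unfolding is_decomposition_def using assms Delta_degree[OF cV] finite_subset[OF sub] fin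
    by (auto, metis add_diff_cancel_right')
  moreover have "is_decomposition V 0 (\<lambda>_. 0)"
    by (simp add: is_decomposition_def zero_in_V)
  ultimately have "?d = (\<lambda>_. 0)"
    using direct_sum[of 0] by blast
  then have "\<Delta> (c j) = 0" for j
    by (metis diff_add_cancel)
  then show ?thesis
    unfolding v using cV by (intro span_sum span_base) auto
qed

text \<open>
  Extend a basis of the boundaries to a basis of the cycles by homogeneous cycles; the added
  vectors \<open>C\<close> are independent modulo boundaries and span the cycles modulo boundaries.
\<close>

lemma homogeneous_complement_exists:
  obtains C where "\<And>x. x \<in> C \<Longrightarrow> \<Delta> x = 0 \<and> (\<exists>j. x \<in> V j)"
    and "\<And>T a. finite T \<Longrightarrow> T \<subseteq> C \<Longrightarrow> (\<Sum>x\<in>T. scale (a x) x) \<in> range \<Delta> \<Longrightarrow> \<forall>x\<in>T. a x = 0"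
    and "\<And>v. \<Delta> v = 0 \<Longrightarrow> \<exists>w\<in>span C. v - w \<in> range \<Delta>"
proof -
  let ?S = "{w. \<Delta> w = 0 \<and> (\<exists>j. w \<in> V j)}"
  obtain R where R: "R \<subseteq> range \<Delta>" "independent R" "range \<Delta> \<subseteq> span R"
    using maximal_independent_subset[of "range \<Delta>"] by blast
  obtain B where B: "R \<subseteq> B" "B \<subseteq> R \<union> ?S" "independent B" "R \<union> ?S \<subseteq> span B"
    using maximal_independent_subset_extend[of R "R \<union> ?S"] R(2) by blast
  have span_R: "span R = range \<Delta>"
    using R span_subspace subspace_range_Delta by blast
  show thesis
  proof (rule that[of "B - R"])
    show "\<Delta> x = 0 \<and> (\<exists>j. x \<in> V j)" if "x \<in> B - R" for x
      using that B(2) by blast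
  next
    fix T a
    assume T: "finite T" "T \<subseteq> B - R" and sum: "(\<Sum>x\<in>T. scale (a x) x) \<in> range \<Delta>"
    show "\<forall>x\<in>T. a x = 0"
    proof (rule ccontr)
      assume "\<not> (\<forall>x\<in>T. a x = 0)"
      then obtain x where x: "x \<in> T" "a x \<noteq> 0" by blast
      have "(\<Sum>y\<in>T. scale (a y) y) \<in> span (B - {x})"
        using sum span_R span_mono[of R "B - {x}"] B(1) T(2) x(1) by blast
      moreover have "(\<Sum>y\<in>T - {x}. scale (a y) y) \<in> span (B - {x})"
        using T(2) by (intro span_sum span_scale span_base) auto
      ultimately have "scale (a x) x \<in> span (B - {x})"
        using span_diff sum.remove[OF T(1) x(1), of "\<lambda>y. scale (a y) y"] by fastforce
      then have "scale (inverse (a x)) (scale (a x) x) \<in> span (B - {x})"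
        by (rule span_scale)
      then have "x \<in> span (B - {x})"
        using x(2) by simp
      then show False
        using B(3) x(1) T(2) unfolding dependent_def by blast
    qed
  next
    fix v assume "\<Delta> v = 0"
    then have "v \<in> span ?S" by (rule cycle_sum_homogeneous_cycles)
    also have "span ?S \<subseteq> span B"
      using B(4) by (intro span_minimal subspace_span) auto
    also have "B = R \<union> (B - R)"
      using B(1) by blast
    finally obtain y w where "y \<in> span R" "w \<in> span (B - R)" "v = y + w"
      unfolding span_Un by blast
    then show "\<exists>w\<in>span (B - R). v - w \<in> range \<Delta>"
      using span_R by (intro bexI[of _ w]) auto
  qed
qed

lemma homogeneous_basis_exists: "\<exists>B deg. homogeneous_basis B deg"
proof -
  obtain C where cycle: "\<And>x. x \<in> C \<Longrightarrow> \<Delta> x = 0 \<and> (\<exists>j. x \<in> V j)"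
    and indep: "\<And>T a. finite T \<Longrightarrow> T \<subseteq> C \<Longrightarrow> (\<Sum>x\<in>T. scale (a x) x) \<in> range \<Delta> \<Longrightarrow> \<forall>x\<in>T. a x = 0"
    and spanning: "\<And>v. \<Delta> v = 0 \<Longrightarrow> \<exists>w\<in>span C. v - w \<in> range \<Delta>"
    using homogeneous_complement_exists by blast
  let ?cl = "\<lambda>x. {x} + range \<Delta>"
  have inj: "inj_on ?cl C"
  proof (rule inj_onI, rule ccontr)
    fix x y assume xy: "x \<in> C" "y \<in> C" "?cl x = ?cl y" "x \<noteq> y"
    then have "(\<Sum>z\<in>{x, y}. scale (if z = x then 1 else - 1) z) \<in> range \<Delta>"
      by (simp add: coset_eq_iff)
    then show False
      using indep[of "{x, y}" "\<lambda>z. if z = x then 1 else - 1"] xy by auto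
  qed
  define \<gamma> where "\<gamma> = inv_into C ?cl"
  have rep: "\<gamma> (?cl x) = x" if "x \<in> C" for x
    unfolding \<gamma>_def using inj that by (rule inv_into_f_f)
  have comb: "class_comb c F = {\<Sum>x\<in>\<gamma> ` F. scale (c (?cl x)) x} + range \<Delta>"
    if F: "finite F" "F \<subseteq> ?cl ` C" for F c
  proof -
    have cl: "b = ?cl (\<gamma> b)" if "b \<in> F" for b
      using F(2) that rep by auto
    then have "inj_on \<gamma> F" by (metis inj_onI)
    moreover have "(\<Sum>b\<in>F. scale (c b) (\<gamma> b)) = (\<Sum>b\<in>F. scale (c (?cl (\<gamma> b))) (\<gamma> b))"
      using cl by (intro sum.cong refl) metis
    ultimately show ?thesis
      using class_comb_eq[OF F(1) cl, of c] by (simp add: sum.reindex)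
  qed
  have "homology_basis (?cl ` C)"
    unfolding homology_basis_def
  proof (intro conjI allI impI ballI)
    show "?cl ` C \<subseteq> homology"
      using cycle by (auto simp: homology_def)
  next
    fix F c b assume F: "finite F \<and> F \<subseteq> ?cl ` C \<and> class_comb c F = range \<Delta>" and b: "b \<in> F"
    have "{\<Sum>x\<in>\<gamma> ` F. scale (c (?cl x)) x} + range \<Delta> = {0} + range \<Delta>"
      using F comb[of F c] by (simp flip: set_zero)
    then have "(\<Sum>x\<in>\<gamma> ` F. scale (c (?cl x)) x) \<in> range \<Delta>"
      unfolding coset_eq_iff by simp
    moreover have "\<gamma> ` F \<subseteq> C"
      using F rep by auto
    ultimately have "c (?cl (\<gamma> b)) = 0"
      using indep[of "\<gamma> ` F" "\<lambda>x. c (?cl x)"] F b by blast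
    then show "c b = 0"
      using F b rep by auto
  next
    fix h assume "h \<in> homology"
    then obtain v where h: "h = ?cl v" and "\<Delta> v = 0"
      by (auto simp: homology_def)
    then obtain w where w: "w \<in> span C" "v - w \<in> range \<Delta>"
      using spanning by blast
    then obtain T a where T: "finite T" "T \<subseteq> C" "w = (\<Sum>x\<in>T. scale (a x) x)"
      unfolding span_explicit by blast
    have "w - v \<in> range \<Delta>"
      using subspace_neg[OF subspace_range_Delta w(2)] by simp
    have img: "\<gamma> ` ?cl ` T = T"
      using T(2) rep by (force simp: image_iff)
    have "(\<Sum>x\<in>T. scale (a (\<gamma> (?cl x))) x) = w"
      unfolding T(3) using T(2) rep by (intro sum.cong refl) auto
    then have "class_comb (\<lambda>b. a (\<gamma> b)) (?cl ` T) = h"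
      using comb[of "?cl ` T" "\<lambda>b. a (\<gamma> b)"] T(1,2) \<open>w - v \<in> range \<Delta>\<close>
      by (simp add: img image_mono h coset_eq_iff)
    then show "\<exists>F c. finite F \<and> F \<subseteq> ?cl ` C \<and> h = class_comb c F"
      using T(1,2) by (intro exI[of _ "?cl ` T"] exI[of _ "\<lambda>b. a (\<gamma> b)"]) auto
  qed
  moreover have "\<exists>j. b \<inter> V j \<noteq> {}" if b: "b \<in> ?cl ` C" for b
  proof -
    obtain x where x: "x \<in> C" "b = ?cl x"
      using b by blast
    then obtain j where "x \<in> V j"
      using cycle by blast
    moreover have "x \<in> ?cl x"
      by (simp add: mem_coset_iff subspace_0[OF subspace_range_Delta])
    ultimately show ?thesis
      unfolding x(2) by blast
  qed
  ultimately show ?thesis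
    unfolding homogeneous_basis_def by metis
qed

end

section \<open>Smooth formality\<close>

context bv_algebra
begin

lemma homology_member_closed: "b \<in> homology \<Longrightarrow> x \<in> b \<Longrightarrow> \<Delta> x = 0"
  by (auto simp: homology_def set_plus_def Delta.add Delta_Delta)

text \<open>
  The solution is \<open>log (1 + X)\<close> with \<open>X = \<Sum>\<^sub>b \<gamma>\<^sub>b t\<^sup>b\<close> for homogeneous representatives \<open>\<gamma>\<^sub>b\<close>; every
  element of a class in \<open>homology\<close> is closed, so \<open>\<Delta> X = 0\<close>.
\<close>

lemma versal_solution_exists:
  assumes "homogeneous_basis B deg" "linear_order_on B r"
  shows "\<exists>\<Gamma>. versal_solution B deg r \<Gamma>"
proof -
  interpret bv_power_series scale u V \<Delta> B deg r
    by unfold_locales (rule assms(2))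
  have "\<forall>b\<in>B. \<exists>x. x \<in> b \<and> x \<in> V (deg b)" and B: "B \<subseteq> homology"
    using assms(1) by (auto simp: homogeneous_basis_def homology_basis_def)
  then obtain \<gamma> where \<gamma>: "\<And>b. b \<in> B \<Longrightarrow> \<gamma> b \<in> b \<and> \<gamma> b \<in> V (deg b)"
    by metis
  then have closed: "\<Delta> (\<gamma> b) = 0" if "b \<in> B" for b
    using homology_member_closed B that by blast
  define X where "X m = (if \<exists>b\<in>B. m = {#b#} then \<gamma> (the_elem (set_mset m)) else 0)" for m
  have X_single: "X {#b#} = \<gamma> b" if "b \<in> B" for b
    using that by (simp add: X_def)
  have X_other: "X m = 0" if "\<not> (\<exists>b\<in>B. m = {#b#})" for m
    unfolding X_def using that by (rule if_not_P)
  have X_hom: "X \<in> homogeneous 0"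
  proof (rule homogeneousI)
    fix m show "X m \<in> V (0 - wt m)"
    proof (cases "\<exists>b\<in>B. m = {#b#}")
      case True
      then show ?thesis using \<gamma> X_single by (auto simp: monomial_degree_def)
    qed (simp add: X_other zero_in_V)
  next
    fix m assume "\<not> monom m"
    then have "\<not> (\<exists>b\<in>B. m = {#b#})" by (auto simp: monomial_def split: if_splits)
    then show "X m = 0" by (rule X_other)
  qed
  have X_closed: "ps_Delta X = (\<lambda>_. 0)"
  proof
    fix m show "ps_Delta X m = 0"
      by (cases "\<exists>b\<in>B. m = {#b#}") (auto simp: ps_Delta_def X_single closed X_other)
  qed
  have X_linear: "size m = 1" if "X m \<noteq> 0" for m
    using X_other[of m] that by fastforce
  note X = X_hom X_closed X_linear
  have "logarithm X {#b#} = \<gamma> b" if "b \<in> B" for b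
    using X_single[OF that] pow_one[OF X] by (simp add: logarithm_def)
  moreover have "logarithm X {#} = 0"
    by (simp add: logarithm_def)
  moreover have "logarithm X \<in> power_series B deg" "total_degree deg 0 (logarithm X)"
    using logarithm_homogeneous[OF X] by (simp_all add: homogeneous_def)
  ultimately have "versal_solution B deg r (logarithm X)"
    unfolding versal_solution_def using maurer_cartan_logarithm[OF X] \<gamma> closed by auto
  then show ?thesis by (rule exI[of _ "logarithm X"])
qed

end

theorem theorem1:
  fixes scale :: "'k::field_char_0 \<Rightarrow> 'v::ring \<Rightarrow> 'v"
    and u :: 'v
    and V :: "int \<Rightarrow> 'v set"
    and \<Delta> :: "'v \<Rightarrow> 'v"
  assumes "bv_algebra scale u V \<Delta>"
  shows "bv_algebra.smooth_formal scale V \<Delta>"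
proof -
  interpret bv_algebra scale u V \<Delta> by (rule assms)
  show ?thesis
    unfolding smooth_formal_def using homogeneous_basis_exists versal_solution_exists by blast
qed

end
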